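(* Let $(\mathcal{V},\mathcal{B})$ be a $2$-$(v,k,1)$ design. If $(\mathcal{V},\mathcal{B})$ has a $2$-$(w,k,1)$ subdesign with $v<kw$ and $w^2-w<k(v-1)$, then $(\mathcal{V},\mathcal{B})$ does not have the MMS star property.
   Context: A $2$-$(v,k,1)$ design is a pair $(\mathcal{V},\mathcal{B})$ with $|\mathcal{V}|=v$ and $\mathcal{B}$ a family of $k$-subsets (blocks) of $\mathcal{V}$ such that every pair of distinct elements of $\mathcal{V}$ lies in exactly one block; each element lies in exactly $\frac{v-1}{k-1}$ blocks. A $2$-$(w,k,1)$ subdesign is a $2$-$(w,k,1)$ design $(\mathcal{V}',\mathcal{B}')$ with $\mathcal{V}'\subseteq\mathcal{V}$, $|\mathcal{V}'|=w$, $\mathcal{B}'\subseteq\mathcal{B}$. The design has the MMS star property if for every $f:\mathcal{V}\to\mathbb{R}$ with $\sum_{x\in\mathcal{V}}f(x)=0$, the number of blocks $B$ with $\sum_{x\in B}f(x)\ge 0$ is at least $\frac{v-1}{k-1}$. *)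

theory Defs
  imports Complex_Main
begin

text \<open>Blocks form a set of subsets: for \<open>k \<ge> 2\<close> the condition on pairs excludes repeated blocks.\<close>

definition design_2 :: "'a set \<Rightarrow> 'a set set \<Rightarrow> nat \<Rightarrow> nat \<Rightarrow> bool" where
  "design_2 V \<B> v k \<longleftrightarrow>
     finite V \<and> card V = v \<and>
     (\<forall>B\<in>\<B>. B \<subseteq> V \<and> card B = k) \<and>
     (\<forall>x\<in>V. \<forall>y\<in>V. x \<noteq> y \<longrightarrow> (\<exists>!B. B \<in> \<B> \<and> x \<in> B \<and> y \<in> B))"

definition subdesign_2 ::
  "'a set \<Rightarrow> 'a set set \<Rightarrow> nat \<Rightarrow> nat \<Rightarrow> 'a set \<Rightarrow> 'a set set \<Rightarrow> bool" where
  "subdesign_2 V' \<B>' w k V \<B> \<longleftrightarrow> design_2 V' \<B>' w k \<and> V' \<subseteq> V \<and> \<B>' \<subseteq> \<B>"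

definition mms_star :: "'a set \<Rightarrow> 'a set set \<Rightarrow> nat \<Rightarrow> nat \<Rightarrow> bool" where
  "mms_star V \<B> v k \<longleftrightarrow>
     (\<forall>f :: 'a \<Rightarrow> real. (\<Sum>x\<in>V. f x) = 0 \<longrightarrow>
        real (card {B \<in> \<B>. (\<Sum>x\<in>B. f x) \<ge> 0}) \<ge> (real v - 1) / (real k - 1))"

end

theory Submission
  imports Defs
begin

text \<open>
  Weight the points of the subdesign by \<open>v - w\<close> and all other points by \<open>- w\<close>. A block meeting the
  subdesign in \<open>a\<close> points has total weight \<open>a * v - k * w\<close>, which is negative for \<open>a \<le> 1\<close>. Hence
  every block of nonnegative weight contains two points of the subdesign and is therefore one of its
  blocks; there are only \<open>w (w - 1) / (k (k - 1)) < (v - 1) / (k - 1)\<close> of these.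
\<close>

text \<open>Evaluates the weighting of the main proof both on the whole point set and on a single
  block.\<close>

lemma sum_if_mem_minus_const:
  fixes c d :: real
  assumes "finite B"
  shows "(\<Sum>x\<in>B. (if x \<in> S then c else 0) - d) = real (card (B \<inter> S)) * c - real (card B) * d"
  using assms by (simp add: sum_subtractf sum.If_cases Collect_mem_eq)

lemma card_off_diagonal:
  assumes "finite A"
  shows "card (A \<times> A - Id_on A) = card A * (card A - 1)"
proof -
  have "Id_on A = (\<lambda>x. (x, x)) ` A" by auto
  then have "card (Id_on A) = card A"
    by (simp add: card_image inj_on_def)
  moreover have "Id_on A \<subseteq> A \<times> A" by auto
  ultimately show ?thesis
    using assms by (simp add: card_Diff_subset finite_subset card_cartesian_product diff_mult_distrib2)
qed

lemma design_2_finite_blocks: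
  assumes "design_2 V \<B> v k"
  shows "finite \<B>"
proof (rule finite_subset)
  show "\<B> \<subseteq> Pow V" "finite (Pow V)"
    using assms by (auto simp: design_2_def)
qed

text \<open>Double counting of ordered pairs of distinct points: no such pair lies in two blocks, so
  the off-diagonal squares of the blocks are disjoint subsets of the one of \<open>V\<close>. The
  upper bound is all that the final estimate requires.\<close>

lemma design_2_card_blocks_le:
  assumes "design_2 V \<B> v k"
  shows "card \<B> * (k * (k - 1)) \<le> v * (v - 1)"
proof -
  let ?D = "\<lambda>B. B \<times> B - Id_on B"
  have V: "finite V" "card V = v" and sub: "\<And>B. B \<in> \<B> \<Longrightarrow> B \<subseteq> V \<and> card B = k"
    using assms by (auto simp: design_2_def)
  have fin: "\<And>B. B \<in> \<B> \<Longrightarrow> finite B"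
    using sub V finite_subset by blast
  have disj: "?D B \<inter> ?D C = {}" if "B \<in> \<B>" "C \<in> \<B>" "B \<noteq> C" for B C
  proof (rule ccontr)
    assume "?D B \<inter> ?D C \<noteq> {}"
    then obtain x y where "x \<in> B" "y \<in> B" "x \<in> C" "y \<in> C" "x \<noteq> y" by auto
    then show False
      using assms that unfolding design_2_def by (metis subsetD)
  qed
  have "card \<B> * (k * (k - 1)) = (\<Sum>B\<in>\<B>. card (?D B))"
    using sub fin by (simp add: card_off_diagonal)
  also have "\<dots> = card (\<Union>B\<in>\<B>. ?D B)"
    using design_2_finite_blocks[OF assms] fin disj by (intro card_UN_disjoint[symmetric]) auto
  also have "\<dots> \<le> card (?D V)"
    using V sub by (intro card_mono) auto
  finally show ?thesis
    using V by (simp add: card_off_diagonal)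
qed

text \<open>Two common points of \<open>B\<close> and \<open>V'\<close> lie in some block of
  \<open>\<B>'\<close>. That block also belongs to \<open>\<B>\<close>, so uniqueness there
  identifies it with \<open>B\<close>.\<close>

lemma subdesign_2_block_mem:
  assumes "design_2 V \<B> v k" "subdesign_2 V' \<B>' w k V \<B>"
    and "B \<in> \<B>" "card (B \<inter> V') \<ge> 2"
  shows "B \<in> \<B>'"
proof -
  obtain T where "T \<subseteq> B \<inter> V'" "card T = 2"
    using assms(4) by (meson obtain_subset_with_card_n)
  then obtain x y where xy: "x \<in> B" "y \<in> B" "x \<in> V'" "y \<in> V'" "x \<noteq> y"
    by (auto simp: card_2_iff)
  then obtain C where C: "C \<in> \<B>'" "x \<in> C" "y \<in> C"
    using assms(2) unfolding subdesign_2_def design_2_def by metis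
  then have "C \<in> \<B>" "x \<in> V" "y \<in> V"
    using assms(2) xy by (auto simp: subdesign_2_def)
  then have "B = C"
    using assms(1,3) xy C unfolding design_2_def by metis
  then show ?thesis using C by simp
qed

theorem theorem3:
  fixes V :: "'a set" and \<B> :: "'a set set" and v k w :: nat
  assumes "design_2 V \<B> v k"
    and "\<exists>V' \<B>'. subdesign_2 V' \<B>' w k V \<B>"
    and "v < k * w"
    and "(int w)\<^sup>2 - int w < int k * (int v - 1)"
  shows "\<not> mms_star V \<B> v k"
proof
  assume star: "mms_star V \<B> v k"
  obtain V' \<B>' where sub: "subdesign_2 V' \<B>' w k V \<B>"
    using assms(2) by blast
  have V: "finite V" "card V = v" and blocks: "\<And>B. B \<in> \<B> \<Longrightarrow> finite B \<and> card B = k"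
    using assms(1) by (auto simp: design_2_def intro: finite_subset)
  have V': "V' \<subseteq> V" "card V' = w" and des': "design_2 V' \<B>' w k"
    using sub by (auto simp: subdesign_2_def design_2_def)
  have "w \<le> v"
    using V V' card_mono by blast
  \<comment> \<open>From \<open>w \<le> v < k * w\<close>: \<open>k = 0\<close> would give
    \<open>v < 0\<close>, and \<open>k = 1\<close> would give \<open>v < w\<close>.\<close>
  then have k: "k \<ge> 2"
    using assms(3) by (cases "k = 0 \<or> k = 1") auto
  have w: "w \<ge> 1"
    using assms(3) by (cases w) auto
  define f :: "'a \<Rightarrow> real" where
    "f = (\<lambda>x. (if x \<in> V' then real v else 0) - real w)"
  have "(\<Sum>x\<in>V. f x) = 0"
    using V V' by (simp add: f_def sum_if_mem_minus_const Int_absorb1)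
  then have lower: "(real v - 1) / (real k - 1) \<le> real (card {B \<in> \<B>. (\<Sum>x\<in>B. f x) \<ge> 0})"
    using star unfolding mms_star_def by blast
  have "{B \<in> \<B>. (\<Sum>x\<in>B. f x) \<ge> 0} \<subseteq> \<B>'"
  proof safe
    fix B assume B: "B \<in> \<B>" "(\<Sum>x\<in>B. f x) \<ge> 0"
    then have "real (k * w) \<le> real (card (B \<inter> V') * v)"
      using blocks by (simp add: f_def sum_if_mem_minus_const)
    \<comment> \<open>Chains \<open>v < k * w\<close> with the previous bound; an intersection of
      size 0 or 1 would then give \<open>v < 0\<close> or \<open>v < v\<close>.\<close>
    then have "v < card (B \<inter> V') * v"
      using assms(3) by linarith
    then have "card (B \<inter> V') \<ge> 2"
      by (cases "card (B \<inter> V') = 0 \<or> card (B \<inter> V') = 1") auto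
    then show "B \<in> \<B>'"
      using subdesign_2_block_mem[OF assms(1) sub B(1)] by simp
  qed
  then have "card {B \<in> \<B>. (\<Sum>x\<in>B. f x) \<ge> 0} \<le> card \<B>'"
    by (rule card_mono[OF design_2_finite_blocks[OF des']])
  with lower have "(real v - 1) / (real k - 1) \<le> real (card \<B>')"
    by linarith
  then have "real v - 1 \<le> real (card \<B>') * (real k - 1)"
    using k by (simp add: pos_divide_le_eq)
  \<comment> \<open>The factor \<open>k\<close> turns the right side into the number of ordered
    pairs covered by \<open>\<B>'\<close>, at most \<open>w * (w - 1)\<close>. Since
    \<open>w \<ge> 1\<close>, the truncated \<open>w - 1\<close> is a true difference, so the last
    hypothesis closes the cycle.\<close>
  then have "real k * (real v - 1) \<le> real k * (real (card \<B>') * (real k - 1))"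
    by (rule mult_left_mono) simp
  also have "\<dots> = real (card \<B>' * (k * (k - 1)))"
    using k by (simp add: of_nat_diff)
  also have "\<dots> \<le> real (w * (w - 1))"
    using design_2_card_blocks_le[OF des'] of_nat_le_iff by blast
  also have "\<dots> = real_of_int ((int w)\<^sup>2 - int w)"
    using w by (simp add: of_nat_diff power2_eq_square algebra_simps)
  also have "\<dots> < real_of_int (int k * (int v - 1))"
    using assms(4) of_int_less_iff by blast
  finally show False by simp
qed

end
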